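(* Let $n,m\in\mathbb{N}$ and let $S$ be a set of lattice points in the plane with $|S|\ge 2$. Let $n,m,c$ be such that $G_{n,m}$ is not $(c,S)_2$-colorable. Then any tree resolution proof that $GRID(n,m,c;S_2)$ is not satisfiable requires size $2^{\Omega(c)}$.
   Context: $G_{n,m}=[n]\times[m]$ where $[x]=\{1,\ldots,x\}$. For a set of lattice points $S=\{(x_1,y_1),\ldots,(x_L,y_L)\}$, let $\mathrm{halfstretch}(S)=\bigcup_{s\in\mathbb{Q}}\{\{(sx_1,sy_1),\ldots,(sx_L,sy_L)\}\}$ (uniform scaling by a single factor $s$), let $\mathrm{translate}(T)=\bigcup_{a,b\in\mathbb{Q}}\{\{(u_1+a,v_1+b),\ldots,(u_L+a,v_L+b)\}\}$ for each set $T=\{(u_1,v_1),\ldots,(u_L,v_L)\}$ in the family, and $\mathrm{avoid}_2(S)=\mathrm{translate}(\mathrm{halfstretch}(S))$. (For example, if $S=\{(0,0),(1,0),(0,1),(1,1)\}$, $\mathrm{avoid}_2(S)$ is the family of axis-parallel squares.) A (partial or full) mapping $\chi$ from $G_{n,m}$ into $[c]$ is a $(c,S)_2$-coloring if no set in $\mathrm{avoid}_2(S)$ (lying in the grid) is monochromatic. $GRID(n,m,c;S_2)$ is the CNF Boolean formula expressing that $G_{n,m}$ is $(c,S)_2$-colorable: variables $x_{ijk}$ ($1\le i\le n$, $1\le j\le m$, $1\le k\le c$) meaning point $(i,j)$ gets color $k$; for each $(i,j)$ a clause $\bigvee_{k=1}^c x_{ijk}$; and for each color $k$ and each set in $\mathrm{avoid}_2(S)$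 contained in the grid, a clause stating that not all its points have color $k$ (details omitted in the paper). A resolution proof that a CNF formula is unsatisfiable is a sequence of clauses, each an input clause or obtained from earlier clauses $A\vee x$ and $B\vee\neg x$ as $A\vee B$, ending in the empty clause; a tree resolution proof is one whose underlying graph is a tree.
   Formalization: The scaling factor s in halfstretch ranges over the nonzero rationals; with s = 0 allowed every single point would be a forbidden set and GRID would have tree refutations of size 2c+1, making the claim false. *)

theory Defs
  imports Complex_Main
begin

definition grid :: "nat \<Rightarrow> nat \<Rightarrow> (nat \<times> nat) set" where
  "grid n m = {1..n} \<times> {1..m}"

text \<open>
  The scaling factor \<open>0\<close> is excluded: it would collapse the pattern to a single point, which is
  always monochromatic, so that no nonempty grid could be colored.
\<close>

definition halfstretch :: "(int \<times> int) set \<Rightarrow> (rat \<times> rat) set set" where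
  "halfstretch S = {(\<lambda>(x, y). (s * of_int x, s * of_int y)) ` S | s. s \<noteq> 0}"

definition translate :: "(rat \<times> rat) set set \<Rightarrow> (rat \<times> rat) set set" where
  "translate F = {(\<lambda>(u, v). (u + a, v + b)) ` T | T a b. T \<in> F}"

definition avoid2 :: "(int \<times> int) set \<Rightarrow> (rat \<times> rat) set set" where
  "avoid2 S = translate (halfstretch S)"

definition avoid2_grid :: "nat \<Rightarrow> nat \<Rightarrow> (int \<times> int) set \<Rightarrow> (nat \<times> nat) set set" where
  "avoid2_grid n m S =
     {T. T \<subseteq> grid n m \<and> (\<lambda>(i, j). (of_nat i, of_nat j)) ` T \<in> avoid2 S}"

text \<open>A coloring may be partial; a grid is colorable if it has a total coloring.\<close>

definition coloring2 ::
  "nat \<Rightarrow> nat \<Rightarrow> nat \<Rightarrow> (int \<times> int) set \<Rightarrow> (nat \<times> nat \<rightharpoonup> nat) \<Rightarrow> bool" where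
  "coloring2 n m c S \<chi> \<longleftrightarrow>
     dom \<chi> \<subseteq> grid n m \<and> ran \<chi> \<subseteq> {1..c} \<and>
     \<not> (\<exists>T \<in> avoid2_grid n m S. \<exists>k. \<forall>p \<in> T. \<chi> p = Some k)"

definition colorable2 :: "nat \<Rightarrow> nat \<Rightarrow> nat \<Rightarrow> (int \<times> int) set \<Rightarrow> bool" where
  "colorable2 n m c S \<longleftrightarrow> (\<exists>\<chi>. coloring2 n m c S \<chi> \<and> dom \<chi> = grid n m)"

datatype 'v lit = Pos 'v | Neg 'v

type_synonym 'v clause = "'v lit set"

text \<open>The variable \<open>(i, j, k)\<close> says that the point \<open>(i, j)\<close> has color \<open>k\<close>.\<close>

definition GRID2 ::
  "nat \<Rightarrow> nat \<Rightarrow> nat \<Rightarrow> (int \<times> int) set \<Rightarrow> (nat \<times> nat \<times> nat) clause set" where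
  "GRID2 n m c S =
     {{Pos (i, j, k) | k. k \<in> {1..c}} | i j. (i, j) \<in> grid n m} \<union>
     {{Neg (i, j, k) | i j. (i, j) \<in> T} | T k. T \<in> avoid2_grid n m S \<and> k \<in> {1..c}}"

text \<open>
  A resolution proof is a list of clauses, each with its justification: it is an input clause, or
  it is derived from the lines with the two given indices. Its size is the number of lines.
\<close>

datatype justification = Input | Resolve nat nat

type_synonym 'v resolution = "('v clause \<times> justification) list"

definition resolvent :: "'v clause \<Rightarrow> 'v clause \<Rightarrow> 'v clause \<Rightarrow> bool" where
  "resolvent C1 C2 C \<longleftrightarrow>
     (\<exists>x A B. C1 = insert (Pos x) A \<and> C2 = insert (Neg x) B \<and> C = A \<union> B)"

definition resolution_proof :: "'v clause set \<Rightarrow> 'v resolution \<Rightarrow> bool" where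
  "resolution_proof F \<pi> \<longleftrightarrow>
     \<pi> \<noteq> [] \<and> fst (last \<pi>) = {} \<and>
     (\<forall>l < length \<pi>. case snd (\<pi> ! l) of
        Input \<Rightarrow> fst (\<pi> ! l) \<in> F
      | Resolve i j \<Rightarrow> i < l \<and> j < l \<and> resolvent (fst (\<pi> ! i)) (fst (\<pi> ! j)) (fst (\<pi> ! l)))"

text \<open>Trees as connected acyclic undirected graphs; \<open>E\<close> is a symmetric adjacency relation on \<open>V\<close>.\<close>

definition graph_cycle :: "('a \<times> 'a) set \<Rightarrow> 'a list \<Rightarrow> bool" where
  "graph_cycle E p \<longleftrightarrow>
     length p \<ge> 3 \<and> distinct p \<and> successively (\<lambda>u v. (u, v) \<in> E) p \<and> (last p, hd p) \<in> E"

definition tree_graph :: "'a set \<Rightarrow> ('a \<times> 'a) set \<Rightarrow> bool" where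
  "tree_graph V E \<longleftrightarrow>
     V \<noteq> {} \<and> (\<forall>u \<in> V. \<forall>v \<in> V. (u, v) \<in> E\<^sup>*) \<and> \<not> (\<exists>p. graph_cycle E p)"

definition premise_edges :: "'v resolution \<Rightarrow> (nat \<times> nat) set" where
  "premise_edges \<pi> =
     {(h, l). l < length \<pi> \<and> (\<exists>i j. snd (\<pi> ! l) = Resolve i j \<and> h \<in> {i, j})}"

definition tree_resolution_proof :: "'v clause set \<Rightarrow> 'v resolution \<Rightarrow> bool" where
  "tree_resolution_proof F \<pi> \<longleftrightarrow>
     resolution_proof F \<pi> \<and>
     tree_graph {..<length \<pi>} (premise_edges \<pi> \<union> (premise_edges \<pi>)\<inverse>)"

end

theory Submission
  imports Defs
begin

text \<open>
  A Prover--Delayer argument walks from the empty clause towards the input clauses. A state is a set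
  \<open>P\<close> of variables decided true and a set \<open>N\<close> of variables decided false; a variable \<open>(i, j, k)\<close> is
  moreover false for free if making it true would complete a monochromatic pattern of color \<open>k\<close>.
  At a resolution step on a variable that is neither decided nor false for free, both premises
  remain falsified after one more decision, and their derivations are disjoint because the proof is
  a tree; so the bound doubles with each decision. An input clause can only be falsified after \<open>c\<close>
  decisions: it must be the clause of a point, and each of the \<open>c\<close> colors is excluded at that point
  either by a decision in \<open>N\<close> or by a pattern, which has another point with that color in \<open>P\<close>.
  Hence \<open>D = 1\<close> works.
\<close>

section \<open>Directed paths and disjoint derivations\<close>

text \<open>Each vertex is kept between \<open>v\<close> and \<open>w\<close>, so that a common
  vertex of two paths into \<open>i\<close> and \<open>j\<close> is a common ancestor of
  both.\<close>

lemma rtrancl_path: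
  assumes "(v, w) \<in> E\<^sup>*"
  obtains p where "p \<noteq> []" "hd p = v" "last p = w" "successively (\<lambda>x y. (x, y) \<in> E) p"
    "\<And>x. x \<in> set p \<Longrightarrow> (v, x) \<in> E\<^sup>* \<and> (x, w) \<in> E\<^sup>*"
  using assms
proof (induction arbitrary: thesis rule: rtrancl_induct)
  case base
  show ?case by (rule base[of "[v]"]) auto
next
  case (step y z)
  obtain p where p: "p \<noteq> []" "hd p = v" "last p = y" "successively (\<lambda>x y. (x, y) \<in> E) p"
    "\<And>x. x \<in> set p \<Longrightarrow> (v, x) \<in> E\<^sup>* \<and> (x, y) \<in> E\<^sup>*"
    using step.IH by blast
  show ?case
  proof (rule step.prems[of "p @ [z]"])
    show "(v, x) \<in> E\<^sup>* \<and> (x, z) \<in> E\<^sup>*" if "x \<in> set (p @ [z])" for x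
      using that p(5) step.hyps by (auto intro: rtrancl_into_rtrancl)
  qed (use p step.hyps in \<open>auto simp: successively_append_iff\<close>)
qed

lemma rtrancl_increasing_le:
  fixes E :: "('a::preorder) rel"
  assumes "E \<subseteq> {(x, y). x < y}" and "(v, w) \<in> E\<^sup>*"
  shows "v \<le> w"
  using assms(2)
  by (induction rule: rtrancl_induct) (use assms(1) in \<open>auto intro: order.trans less_imp_le\<close>)

lemma successively_increasing_distinct:
  fixes E :: "('a::preorder) rel"
  assumes "E \<subseteq> {(x, y). x < y}" and "successively (\<lambda>x y. (x, y) \<in> E) p"
  shows "distinct p"
proof -
  have "successively (<) p"
    using assms(2) by (rule successively_mono) (use assms(1) in auto)
  then have "sorted_wrt (<) p"
    by (subst (asm) successively_conv_sorted_wrt) (auto intro: transpI less_trans)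
  then show ?thesis
    by (induction p) auto
qed

text \<open>A common ancestor would close an undirected cycle: follow a path from it to
  \<open>i\<close>, step to \<open>l\<close>, and go back through \<open>j\<close>. Edges run from
  premise to conclusion, so these sets are the lines of the two subderivations.\<close>

lemma disjoint_ancestors_if_acyclic:
  fixes E :: "nat rel"
  assumes incr: "E \<subseteq> {(x, y). x < y}"
    and acyc: "\<nexists>p. graph_cycle (E \<union> E\<inverse>) p"
    and il: "(i, l) \<in> E" and jl: "(j, l) \<in> E" and "i \<noteq> j"
  shows "{h. (h, i) \<in> E\<^sup>*} \<inter> {h. (h, j) \<in> E\<^sup>*} = {}"
proof (rule ccontr)
  note le = rtrancl_increasing_le[OF incr]
  let ?A = "{h. (h, i) \<in> E\<^sup>*} \<inter> {h. (h, j) \<in> E\<^sup>*}"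
  assume ne: "?A \<noteq> {}"
  have fin: "finite ?A"
    by (rule finite_subset[of _ "{..i}"]) (auto dest: le)
  \<comment> \<open>For the largest common ancestor, the paths to \<open>i\<close> and \<open>j\<close> meet only at their start.\<close>
  define v where "v = Max ?A"
  have v: "(v, i) \<in> E\<^sup>*" "(v, j) \<in> E\<^sup>*"
    using Max_in[OF fin ne] by (auto simp: v_def)
  obtain p where p: "p \<noteq> []" "hd p = v" "last p = i" "successively (\<lambda>x y. (x, y) \<in> E) p"
    "\<And>x. x \<in> set p \<Longrightarrow> (v, x) \<in> E\<^sup>* \<and> (x, i) \<in> E\<^sup>*"
    using rtrancl_path[OF v(1)] by metis
  obtain q where q: "q \<noteq> []" "hd q = v" "last q = j" "successively (\<lambda>x y. (x, y) \<in> E) q"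
    "\<And>x. x \<in> set q \<Longrightarrow> (v, x) \<in> E\<^sup>* \<and> (x, j) \<in> E\<^sup>*"
    using rtrancl_path[OF v(2)] by metis
  obtain q' where q': "q = v # q'"
    using q(1,2) by (cases q) auto
  have dp: "distinct p" and dq: "distinct q"
    using successively_increasing_distinct[OF incr] p(4) q(4) by auto
  \<comment> \<open>A vertex on both paths is a common ancestor, hence at most the maximum
    \<open>v\<close>; it is reachable from \<open>v\<close>, hence at least
    \<open>v\<close>.\<close>
  have "x = v" if "x \<in> set p" "x \<in> set q" for x
  proof (rule antisym)
    show "x \<le> v"
      unfolding v_def using fin that p(5) q(5) by (intro Max_ge) auto
    show "v \<le> x"
      using le p(5) that by blast
  qed
  then have disj: "set p \<inter> set q' = {}"
    using dq q' by auto
  have l: "l \<notin> set p" "l \<notin> set q'"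
    using le p(5) q(5) incr il jl by (fastforce simp: q')+
  let ?R = "\<lambda>x y. (x, y) \<in> E \<union> E\<inverse>"
  have sp: "successively ?R p"
    using p(4) by (rule successively_mono) auto
  have "successively ?R (rev q')"
    unfolding successively_rev
    by (rule successively_mono[where P = "\<lambda>x y. (x, y) \<in> E"])
      (use q(4) q' in \<open>auto simp: successively_Cons\<close>)
  moreover have "q' \<noteq> [] \<Longrightarrow> last q' = j" "q' = [] \<Longrightarrow> v = j"
    using q(3) q' by auto
  moreover have "q' \<noteq> [] \<Longrightarrow> (v, hd q') \<in> E"
    using q(4) q' by (auto simp: successively_Cons)
  moreover have "length p \<ge> 2" if "q' = []"
    using that p(1-3) \<open>i \<noteq> j\<close> calculation(3) by (cases p) (auto simp: Suc_le_eq)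
  moreover have "length p + length q' \<ge> 2" if "q' \<noteq> []"
    using that p(1) by (cases p; cases q') auto
  \<comment> \<open>The start \<open>v\<close> is dropped from \<open>q\<close> so that it occurs
    only once. If \<open>q'\<close> is empty, then \<open>v = j\<close> and the edge between
    \<open>l\<close> and \<open>j\<close> closes the cycle; \<open>i \<noteq> j\<close> then gives
    \<open>p\<close> two vertices.\<close>
  ultimately have "graph_cycle (E \<union> E\<inverse>) (p @ l # rev q')"
    unfolding graph_cycle_def
    using sp p(1-3) dp dq q' disj l il jl
    by (cases "q' = []")
      (auto simp: successively_append_iff successively_Cons hd_rev last_rev hd_append
        Suc_le_eq less_Suc_eq_0_disj)
  then show False
    using acyc by blast
qed

section \<open>Patterns and decision states\<close>

text \<open>Translations and scalings by a nonzero factor are injective. With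
  \<open>card S \<ge> 2\<close>, every pattern thus has a second point.\<close>

lemma card_avoid2_grid:
  assumes "T \<in> avoid2_grid n m S"
  shows "card T = card S"
proof -
  let ?emb = "\<lambda>(i::nat, j::nat). (of_nat i :: rat, of_nat j :: rat)"
  obtain s a b where s: "s \<noteq> 0"
    and eq: "?emb ` T = (\<lambda>(u, v). (u + a, v + b)) ` (\<lambda>(x, y). (s * of_int x, s * of_int y)) ` S"
    using assms unfolding avoid2_grid_def avoid2_def translate_def halfstretch_def by auto
  have "card T = card (?emb ` T)"
    by (rule card_image[symmetric]) (auto simp: inj_on_def)
  also have "\<dots> = card ((\<lambda>(x, y). (s * of_int x, s * of_int y)) ` S)"
    unfolding eq by (rule card_image) (auto simp: inj_on_def)
  also have "\<dots> = card S"
    using s by (intro card_image) (auto simp: inj_on_def)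
  finally show ?thesis .
qed

definition forced_false ::
  "('p \<times> 'q) set set \<Rightarrow> ('p \<times> 'q \<times> 'k) set \<Rightarrow> ('p \<times> 'q \<times> 'k) set" where
  "forced_false \<T> P = {(i, j, k) | i j k. \<exists>T \<in> \<T>. (i, j) \<in> T \<and>
     (\<forall>(i', j') \<in> T - {(i, j)}. (i', j', k) \<in> P)}"

text \<open>The invariant of the walk: while it holds, no pattern clause is falsified.\<close>

definition no_mono :: "('p \<times> 'q) set set \<Rightarrow> ('p \<times> 'q \<times> 'k) set \<Rightarrow> bool" where
  "no_mono \<T> P \<longleftrightarrow> \<not> (\<exists>T \<in> \<T>. \<exists>k. \<forall>(i, j) \<in> T. (i, j, k) \<in> P)"

text \<open>The walk takes \<open>N \<union> forced_false \<T> P\<close> as second argument, while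
  only \<open>P\<close> and \<open>N\<close> are counted as decisions.\<close>

definition falsified :: "'v set \<Rightarrow> 'v set \<Rightarrow> 'v clause \<Rightarrow> bool" where
  "falsified P N C \<longleftrightarrow> (\<forall>v. (Pos v \<in> C \<longrightarrow> v \<in> N) \<and> (Neg v \<in> C \<longrightarrow> v \<in> P))"

lemma forced_false_mono:
  assumes "P \<subseteq> Q"
  shows "forced_false \<T> P \<subseteq> forced_false \<T> Q"
proof
  fix v
  assume "v \<in> forced_false \<T> P"
  then obtain i j k T where "v = (i, j, k)" "T \<in> \<T>" "(i, j) \<in> T"
    and "\<forall>(i', j') \<in> T - {(i, j)}. (i', j', k) \<in> P"
    unfolding forced_false_def by blast
  moreover from this(4) have "\<forall>(i', j') \<in> T - {(i, j)}. (i', j', k) \<in> Q"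
    using assms by auto
  ultimately show "v \<in> forced_false \<T> Q"
    unfolding forced_false_def by blast
qed

text \<open>A pattern that becomes monochromatic must use \<open>v\<close>, and its other points are
  already in \<open>P\<close>; this is what makes \<open>v\<close> forced false.\<close>

lemma no_mono_insert:
  assumes "no_mono \<T> P" and "v \<notin> forced_false \<T> P"
  shows "no_mono \<T> (insert v P)"
  unfolding no_mono_def
proof
  obtain i j k where v: "v = (i, j, k)"
    by (cases v) auto
  assume "\<exists>T \<in> \<T>. \<exists>k. \<forall>(i, j) \<in> T. (i, j, k) \<in> insert v P"
  then obtain T k' where T: "T \<in> \<T>" "\<forall>(i', j') \<in> T. (i', j', k') \<in> insert v P"
    by (elim bexE exE)
  show False
  proof (cases "(i, j) \<in> T \<and> k = k'")
    case True
    then have "v \<in> forced_false \<T> P"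
      using T v unfolding forced_false_def by auto
    then show False using assms(2) by blast
  next
    case False
    then have "\<forall>(i', j') \<in> T. (i', j', k') \<in> P"
      using T(2) v by auto
    then show False using assms(1) T(1) unfolding no_mono_def by blast
  qed
qed

lemma falsified_insert_Pos:
  "falsified P N A \<Longrightarrow> x \<in> N \<Longrightarrow> falsified P N (insert (Pos x) A)"
  unfolding falsified_def by auto

lemma falsified_insert_Neg:
  "falsified P N A \<Longrightarrow> x \<in> P \<Longrightarrow> falsified P N (insert (Neg x) A)"
  unfolding falsified_def by auto

lemma falsified_mono:
  "falsified P N A \<Longrightarrow> B \<subseteq> A \<Longrightarrow> P \<subseteq> P' \<Longrightarrow> N \<subseteq> N' \<Longrightarrow> falsified P' N' B"
  unfolding falsified_def by blast

section \<open>Counting decisions and proof lines\<close>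

lemma falsified_GRID2_decisions:
  assumes "card S \<ge> 2" and "C \<in> GRID2 n m c S"
    and "finite P" and "finite N" and "no_mono (avoid2_grid n m S) P"
    and "falsified P (N \<union> forced_false (avoid2_grid n m S) P) C"
  shows "c \<le> card P + card N"
proof -
  consider (point) i j where "C = {Pos (i, j, k) | k. k \<in> {1..c}}"
    | (pattern) T k where "T \<in> avoid2_grid n m S" "C = {Neg (i, j, k) | i j. (i, j) \<in> T}"
    using assms(2) unfolding GRID2_def by blast
  then show ?thesis
  proof cases
    case point
    \<comment> \<open>Projecting the decisions to their colors covers all of
      \<open>{1..c}\<close>.\<close>
    let ?col = "\<lambda>(i, j, k). k"
    have "k \<in> ?col ` (P \<union> N)" if k: "k \<in> {1..c}" for k
    proof -
      have "(i, j, k) \<in> N \<union> forced_false (avoid2_grid n m S) P"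
        using assms(6) k point unfolding falsified_def by blast
      then show ?thesis
      proof
        assume "(i, j, k) \<in> forced_false (avoid2_grid n m S) P"
        then obtain T where T: "T \<in> avoid2_grid n m S" "(i, j) \<in> T"
          "\<And>i' j'. (i', j') \<in> T - {(i, j)} \<Longrightarrow> (i', j', k) \<in> P"
          unfolding forced_false_def by auto
        \<comment> \<open>A second point of \<open>T\<close> supplies a decision in \<open>P\<close>
          of color \<open>k\<close>.\<close>
        have "\<not> T \<subseteq> {(i, j)}"
          using card_mono[of "{(i, j)}" T] card_avoid2_grid[OF T(1)] assms(1) by auto
        then show ?thesis
          using T(3) by force
      qed force
    qed
    then have "card {1..c} \<le> card (P \<union> N)"
      using assms(3,4) by (intro surj_card_le[of _ _ ?col]) auto
    then show ?thesis
      using card_Un_le[of P N] by simp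
  next
    case pattern
    then have "\<forall>(i, j) \<in> T. (i, j, k) \<in> P"
      using assms(6) unfolding falsified_def by blast
    then show ?thesis
      using assms(5) pattern(1) unfolding no_mono_def by blast
  qed
qed

text \<open>Induction on the line number with arbitrary \<open>P\<close> and \<open>N\<close>, since
  premises come earlier and the state changes along the walk.\<close>

lemma ancestors_lower_bound:
  fixes \<pi> :: "(nat \<times> nat \<times> nat) resolution"
  assumes S: "card S \<ge> 2"
    and tree: "tree_resolution_proof (GRID2 n m c S) \<pi>"
    and "l < length \<pi>" and "finite P" and "finite N"
    and "no_mono (avoid2_grid n m S) P"
    and "falsified P (N \<union> forced_false (avoid2_grid n m S) P) (fst (\<pi> ! l))"
  shows "2 ^ (c - (card P + card N)) \<le> card {h. (h, l) \<in> (premise_edges \<pi>)\<^sup>*}"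
  using assms(3-)
proof (induction l arbitrary: P N rule: less_induct)
  case (less l)
  define \<T> where "\<T> = avoid2_grid n m S"
  define E where "E = premise_edges \<pi>"
  note finP = less.prems(2) and finN = less.prems(3)
  note nomono = less.prems(4)[folded \<T>_def]
  note fals = less.prems(5)[folded \<T>_def]
  note IH = less.IH[folded \<T>_def E_def]
  have step: "case snd (\<pi> ! l) of Input \<Rightarrow> fst (\<pi> ! l) \<in> GRID2 n m c S
      | Resolve i j \<Rightarrow> i < l \<and> j < l \<and> resolvent (fst (\<pi> ! i)) (fst (\<pi> ! j)) (fst (\<pi> ! l))"
    if "l < length \<pi>" for l
    using tree that unfolding tree_resolution_proof_def resolution_proof_def by blast
  have incr: "E \<subseteq> {(x, y). x < y}"
    using step unfolding E_def premise_edges_def by fastforce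
  have fin: "finite {h. (h, x) \<in> E\<^sup>*}" for x
    by (rule finite_subset[of _ "{..x}"]) (auto dest: rtrancl_increasing_le[OF incr])
  have goal: "2 ^ (c - (card P + card N)) \<le> card {h. (h, l) \<in> E\<^sup>*}"
  proof (cases "c \<le> card P + card N")
    \<comment> \<open>The truncated exponent is 0, and \<open>l\<close> is its own ancestor.\<close>
    case True
    have "{h. (h, l) \<in> E\<^sup>*} \<noteq> {}"
      by blast
    then show ?thesis
      using True fin[of l] by (simp add: Suc_le_eq card_gt_0_iff)
  next
    case False
    then have "fst (\<pi> ! l) \<notin> GRID2 n m c S"
      using falsified_GRID2_decisions[OF S] less.prems by blast
    then obtain i j where ij: "snd (\<pi> ! l) = Resolve i j"
      using step[OF less.prems(1)] by (cases "snd (\<pi> ! l)") auto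
    then have lt: "i < l" "j < l" and "resolvent (fst (\<pi> ! i)) (fst (\<pi> ! j)) (fst (\<pi> ! l))"
      using step[OF less.prems(1)] by auto
    then obtain x A B where C1: "fst (\<pi> ! i) = insert (Pos x) A"
      and C2: "fst (\<pi> ! j) = insert (Neg x) B" and C: "fst (\<pi> ! l) = A \<union> B"
      unfolding resolvent_def by blast
    have edges: "(i, l) \<in> E" "(j, l) \<in> E"
      using ij less.prems(1) unfolding E_def premise_edges_def by auto
    then have sub: "{h. (h, i) \<in> E\<^sup>*} \<subseteq> {h. (h, l) \<in> E\<^sup>*}" "{h. (h, j) \<in> E\<^sup>*} \<subseteq> {h. (h, l) \<in> E\<^sup>*}"
      by (auto intro: rtrancl_into_rtrancl)
    let ?N = "N \<union> forced_false \<T> P"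
    have len: "i < length \<pi>" "j < length \<pi>"
      using lt less.prems(1) by auto
    have fA: "falsified P ?N A" and fB: "falsified P ?N B"
      using fals C by (auto intro: falsified_mono)
    consider "x \<in> P" | "x \<in> ?N" | (free) "x \<notin> P" "x \<notin> ?N"
      by blast
    then show ?thesis
    proof cases
      \<comment> \<open>The value of \<open>x\<close> is known here and in the next case, so the
        walk moves to the falsified premise without a decision.\<close>
      case 1
      then have "2 ^ (c - (card P + card N)) \<le> card {h. (h, j) \<in> E\<^sup>*}"
        using fB C2 by (intro IH[OF lt(2) len(2) finP finN nomono]) (simp add: falsified_insert_Neg)
      also have "\<dots> \<le> card {h. (h, l) \<in> E\<^sup>*}"
        by (rule card_mono[OF fin sub(2)])
      finally show ?thesis .
    next
      case 2
      then have "2 ^ (c - (card P + card N)) \<le> card {h. (h, i) \<in> E\<^sup>*}"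
        using fA C1 by (intro IH[OF lt(1) len(1) finP finN nomono]) (simp add: falsified_insert_Pos)
      also have "\<dots> \<le> card {h. (h, l) \<in> E\<^sup>*}"
        by (rule card_mono[OF fin sub(1)])
      finally show ?thesis .
    next
      case free
      \<comment> \<open>The exponent left after one more decision: deciding \<open>x\<close> false
        falsifies premise \<open>i\<close>, deciding it true falsifies premise
        \<open>j\<close>.\<close>
      define d where "d = c - Suc (card P + card N)"
      have "2 ^ (c - (card P + card (insert x N))) \<le> card {h. (h, i) \<in> E\<^sup>*}"
        using fA C1 finN
        by (intro IH[OF lt(1) len(1) finP _ nomono])
          (auto intro!: falsified_insert_Pos intro: falsified_mono)
      then have I: "2 ^ d \<le> card {h. (h, i) \<in> E\<^sup>*}"
        using free finN by (simp add: d_def)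
      \<comment> \<open>Enlarging \<open>P\<close> only enlarges the forced variables, so
        \<open>B\<close> stays falsified.\<close>
      have "falsified (insert x P) (N \<union> forced_false \<T> (insert x P)) (insert (Neg x) B)"
        using forced_false_mono[of P "insert x P" \<T>]
        by (intro falsified_insert_Neg falsified_mono[OF fB]) auto
      then have "2 ^ (c - (card (insert x P) + card N)) \<le> card {h. (h, j) \<in> E\<^sup>*}"
        using C2 finP finN no_mono_insert[OF nomono] free(2)
        by (intro IH[OF lt(2) len(2)]) auto
      then have J: "2 ^ d \<le> card {h. (h, j) \<in> E\<^sup>*}"
        using free finP by (simp add: d_def)
      \<comment> \<open>If \<open>i = j\<close>, this clause contains both literals of \<open>x\<close>, so the resolvent contains one.\<close>
      have "i \<noteq> j"
      proof
        assume "i = j"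
        then have "Pos x \<in> B"
          using C1 C2 by auto
        then show False
          using fB free(2) unfolding falsified_def by blast
      qed
      then have disj: "{h. (h, i) \<in> E\<^sup>*} \<inter> {h. (h, j) \<in> E\<^sup>*} = {}"
        using tree disjoint_ancestors_if_acyclic[OF incr _ edges]
        unfolding tree_resolution_proof_def tree_graph_def E_def by blast
      have "2 ^ (c - (card P + card N)) = (2 ^ d + 2 ^ d :: nat)"
        using False by (simp add: d_def Suc_diff_Suc flip: mult_2 power_Suc)
      also have "\<dots> \<le> card {h. (h, i) \<in> E\<^sup>*} + card {h. (h, j) \<in> E\<^sup>*}"
        using I J by (rule add_mono)
      also have "\<dots> = card ({h. (h, i) \<in> E\<^sup>*} \<union> {h. (h, j) \<in> E\<^sup>*})"
        by (rule card_Un_disjoint[OF fin fin disj, symmetric])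
      also have "\<dots> \<le> card {h. (h, l) \<in> E\<^sup>*}"
        using sub by (intro card_mono[OF fin]) auto
      finally show ?thesis .
    qed
  qed
  then show ?case
    unfolding E_def .
qed

lemma tree_resolution_GRID2_size:
  assumes "card S \<ge> 2" and "tree_resolution_proof (GRID2 n m c S) \<pi>"
  shows "2 ^ c \<le> length \<pi>"
proof -
  let ?l = "length \<pi> - 1"
  have res: "resolution_proof (GRID2 n m c S) \<pi>"
    using assms(2) unfolding tree_resolution_proof_def by blast
  then have l: "?l < length \<pi>" and empty: "fst (\<pi> ! ?l) = {}"
    unfolding resolution_proof_def by (auto simp: last_conv_nth)
  \<comment> \<open>The walk starts at the last line without decisions. Only an empty pattern could
    be monochromatic in the empty state.\<close>
  have "no_mono (avoid2_grid n m S) ({} :: (nat \<times> nat \<times> nat) set)"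
    unfolding no_mono_def
  proof
    assume "\<exists>T \<in> avoid2_grid n m S. \<exists>k. \<forall>(i, j) \<in> T. (i, j, k) \<in> ({} :: (nat \<times> nat \<times> nat) set)"
    then have "{} \<in> avoid2_grid n m S"
      by (metis case_prodD empty_iff equals0I surj_pair)
    then show False
      using card_avoid2_grid assms(1) by fastforce
  qed
  then have "2 ^ c \<le> card {h. (h, ?l) \<in> (premise_edges \<pi>)\<^sup>*}"
    using ancestors_lower_bound[OF assms l, of "{}" "{}"] empty by (simp add: falsified_def)
  also have "\<dots> \<le> card {..<length \<pi>}"
  proof (rule card_mono)
    have "premise_edges \<pi> \<subseteq> {(x, y). x < y}"
      using res unfolding premise_edges_def resolution_proof_def by fastforce
    then show "{h. (h, ?l) \<in> (premise_edges \<pi>)\<^sup>*} \<subseteq> {..<length \<pi>}"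
      using rtrancl_increasing_le[of "premise_edges \<pi>"] l by fastforce
  qed simp
  finally show ?thesis
    by simp
qed

theorem theorem6p11:
  shows "\<exists>D::real. D > 0 \<and>
    (\<forall>(n::nat) (m::nat) (c::nat) (S :: (int \<times> int) set) (\<pi> :: (nat \<times> nat \<times> nat) resolution).
       finite S \<longrightarrow> card S \<ge> 2 \<longrightarrow> \<not> colorable2 n m c S \<longrightarrow>
       tree_resolution_proof (GRID2 n m c S) \<pi> \<longrightarrow>
       2 powr (D * real c) \<le> real (length \<pi>))"
proof (intro exI[of _ 1] conjI allI impI)
  fix n m c :: nat and S :: "(int \<times> int) set" and \<pi> :: "(nat \<times> nat \<times> nat) resolution"
  assume "card S \<ge> 2" "tree_resolution_proof (GRID2 n m c S) \<pi>"
  then have "real (2 ^ c) \<le> real (length \<pi>)"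
    using tree_resolution_GRID2_size by (intro of_nat_mono)
  then show "2 powr (1 * real c) \<le> real (length \<pi>)"
    by (simp add: powr_realpow)
qed simp

end
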